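(* Let $G=(V,E)$ be a finite graph and let $u,v\in V$ be adjacent, with $d_u\geq 2$ or $d_v\geq 2$. Then $$r_{uv}\geq\max\left\{\frac{d_v+d_u-2}{d_ud_v-1},\ \frac{4}{d_u+d_v+2}\right\}.$$
   Context: $d_w$ denotes the degree of vertex $w$. For a finite graph with Laplacian $\mathbf{L}=\mathbf{D}-\mathbf{A}$ (degree matrix minus adjacency matrix) and Moore--Penrose pseudoinverse $\mathbf{L}^\dagger$, the effective resistance is $r_{uv}=(\mathbf{1}_u-\mathbf{1}_v)^\top\mathbf{L}^\dagger(\mathbf{1}_u-\mathbf{1}_v)$, where $\mathbf{1}_u$ is the indicator vector of $u$. *)

theory Defs
  imports "HOL-Analysis.Analysis"
begin

text \<open>
  A finite simple graph is given by its adjacency relation, symmetric and irreflexive, on a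
  finite type: the vertex set \<open>V\<close> is the whole type. Connectedness is not required.
\<close>

definition simple_graph :: "('v::finite \<Rightarrow> 'v \<Rightarrow> bool) \<Rightarrow> bool" where
  "simple_graph E \<longleftrightarrow> symp E \<and> irreflp E"

definition vertex_degree :: "('v::finite \<Rightarrow> 'v \<Rightarrow> bool) \<Rightarrow> 'v \<Rightarrow> nat" where
  "vertex_degree E w = card {x. E w x}"

definition adjacency_matrix :: "('v::finite \<Rightarrow> 'v \<Rightarrow> bool) \<Rightarrow> real^'v^'v" where
  "adjacency_matrix E = (\<chi> x y. if E x y then 1 else 0)"

definition degree_matrix :: "('v::finite \<Rightarrow> 'v \<Rightarrow> bool) \<Rightarrow> real^'v^'v" where
  "degree_matrix E = (\<chi> x y. if x = y then real (vertex_degree E x) else 0)"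

definition laplacian :: "('v::finite \<Rightarrow> 'v \<Rightarrow> bool) \<Rightarrow> real^'v^'v" where
  "laplacian E = degree_matrix E - adjacency_matrix E"

text \<open>
  The four Penrose conditions; every real matrix has exactly one such \<open>X\<close>, so the definite
  description in \<open>pseudoinverse\<close> always denotes.
\<close>

definition is_pseudoinverse :: "real^'n^'m \<Rightarrow> real^'m^'n \<Rightarrow> bool" where
  "is_pseudoinverse A X \<longleftrightarrow>
     A ** X ** A = A \<and> X ** A ** X = X \<and>
     transpose (A ** X) = A ** X \<and> transpose (X ** A) = X ** A"

definition pseudoinverse :: "real^'n^'m \<Rightarrow> real^'m^'n" where
  "pseudoinverse A = (THE X. is_pseudoinverse A X)"

definition effective_resistance :: "('v::finite \<Rightarrow> 'v \<Rightarrow> bool) \<Rightarrow> 'v \<Rightarrow> 'v \<Rightarrow> real" where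
  "effective_resistance E u v =
     (axis u 1 - axis v 1) \<bullet> (pseudoinverse (laplacian E) *v (axis u 1 - axis v 1))"

end

theory Submission
  imports Defs
begin

text \<open>
  The signed indicator \<open>b\<close> of an edge \<open>uv\<close> is orthogonal to the kernel of the Laplacian \<open>L\<close>, so
  \<open>b = L z\<close> for \<open>z = L\<^sup>\<dagger> b\<close>. Expanding \<open>(z - x) \<bullet> L (z - x) \<ge> 0\<close> gives the Dirichlet bound
  \<open>r \<ge> 2 (b \<bullet> x) - x \<bullet> L x\<close> for every potential \<open>x\<close>. Both lower bounds come from potentials supported
  on \<open>{u, v}\<close>: the optimal one yields the first bound and the antisymmetric one the second.
\<close>

section \<open>Matrix algebra and orthogonal projections\<close>

lemma matrix_add_rdistrib:
  fixes A B :: "'a::semiring_1^'n^'m"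
  shows "(A + B) ** C = A ** C + B ** C"
  by (simp add: matrix_matrix_mult_def vec_eq_iff distrib_right sum.distrib)

lemma matrix_diff_ldistrib:
  fixes B C :: "'a::ring_1^'n^'m"
  shows "A ** (B - C) = A ** B - A ** C"
  by (simp add: matrix_matrix_mult_def vec_eq_iff right_diff_distrib sum_subtractf)

lemma matrix_diff_rdistrib:
  fixes A B :: "'a::ring_1^'n^'m"
  shows "(A - B) ** C = A ** C - B ** C"
  by (simp add: matrix_matrix_mult_def vec_eq_iff left_diff_distrib sum_subtractf)

lemma symmetric_matrix_dot_commute:
  fixes A :: "real^'n^'n"
  assumes "transpose A = A"
  shows "x \<bullet> (A *v y) = (A *v x) \<bullet> y"
  by (metis assms dot_lmul_matrix vector_transpose_matrix)

text \<open>The sum of the outer products \<open>b b\<^sup>T\<close> over an orthonormal basis of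
  \<open>S\<close> works: its values are combinations of basis vectors, and since it fixes each of
  these, it fixes their span by linearity.\<close>

lemma orthogonal_projection_matrix_exists:
  fixes S :: "(real^'n) set"
  assumes "subspace S"
  obtains P :: "real^'n^'n" where "transpose P = P" "\<And>x. P *v x \<in> S" "\<And>x. x \<in> S \<Longrightarrow> P *v x = x"
proof -
  obtain B where B: "B \<subseteq> S" "pairwise orthogonal B" "\<And>x. x \<in> B \<Longrightarrow> norm x = 1"
    "independent B" "span B = S"
    using orthonormal_basis_subspace[OF assms] by metis
  have "finite B"
    using B(4) independent_bound by blast
  define P :: "real^'n^'n" where "P = (\<chi> i j. \<Sum>b\<in>B. b $ i * b $ j)"
  have P: "P *v x = (\<Sum>b\<in>B. (b \<bullet> x) *\<^sub>R b)" for x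
  proof -
    have "(\<Sum>j\<in>UNIV. (\<Sum>b\<in>B. b $ i * b $ j) * x $ j) = (\<Sum>b\<in>B. (b \<bullet> x) * b $ i)" for i
      unfolding sum_distrib_right inner_vec_def by (subst sum.swap) (simp add: mult_ac)
    then show ?thesis
      by (simp add: vec_eq_iff P_def matrix_vector_mult_def)
  qed
  have fixB: "P *v b = b" if "b \<in> B" for b
  proof -
    have "(c \<bullet> b) *\<^sub>R c = (if c = b then b else 0)" if "c \<in> B" for c
      using B(2,3) that \<open>b \<in> B\<close>
      by (auto simp: pairwise_def orthogonal_def norm_eq_1)
    then have "P *v b = (\<Sum>c\<in>B. if c = b then b else 0)"
      unfolding P by (intro sum.cong) auto
    then show ?thesis
      using \<open>finite B\<close> \<open>b \<in> B\<close> by simp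
  qed
  show thesis
  proof
    show "transpose P = P"
      by (simp add: P_def transpose_def mult.commute)
    show "P *v x \<in> S" for x
      unfolding P using B(1) assms by (intro subspace_sum subspace_mul) auto
    show "P *v x = x" if "x \<in> S" for x
    proof -
      have "x \<in> span B"
        using that B(5) by simp
      then show ?thesis
        by (induction rule: span_induct_alt)
          (simp_all add: matrix_vector_right_distrib matrix_vector_mult_scaleR fixB)
    qed
  qed
qed

section \<open>Pseudoinverses of symmetric matrices\<close>

text \<open>Both \<open>A ** X\<close> and \<open>A ** Y\<close> are the orthogonal projection onto
  the range of \<open>A\<close>, so they agree; likewise \<open>X ** A = Y ** A\<close>. Then X =
  XAX = XAY = YAY = Y.\<close>

lemma is_pseudoinverse_unique:
  assumes "is_pseudoinverse A X" "is_pseudoinverse A Y"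
  shows "X = Y"
proof -
  note X = assms(1)[unfolded is_pseudoinverse_def]
  note Y = assms(2)[unfolded is_pseudoinverse_def]
  have "A ** X = (A ** Y) ** (A ** X)"
    using Y by (metis matrix_mul_assoc)
  also have "\<dots> = transpose ((A ** X) ** (A ** Y))"
    using X Y by (simp add: matrix_transpose_mul)
  also have "\<dots> = A ** Y"
    using X Y by (metis matrix_mul_assoc)
  finally have 1: "A ** X = A ** Y" .
  have "X ** A = (X ** A) ** (Y ** A)"
    using Y by (metis matrix_mul_assoc)
  also have "\<dots> = transpose ((Y ** A) ** (X ** A))"
    using X Y by (simp add: matrix_transpose_mul)
  also have "\<dots> = Y ** A"
    using X Y by (metis matrix_mul_assoc)
  finally have 2: "X ** A = Y ** A" .
  show ?thesis
    using X Y 1 2 by (metis matrix_mul_assoc)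
qed

text \<open>
  With \<open>P\<close> the orthogonal projection onto the kernel of \<open>A\<close>, the matrix \<open>A + P\<close> is invertible and
  \<open>(A + P)\<^sup>-\<^sup>1 - P\<close> inverts \<open>A\<close> on the orthogonal complement of the kernel.
\<close>

lemma pseudoinverse_exists:
  fixes A :: "real^'n^'n"
  assumes sym: "transpose A = A"
  shows "\<exists>X. is_pseudoinverse A X"
proof -
  have "subspace {x. A *v x = 0}"
    by (auto simp: subspace_def matrix_vector_right_distrib matrix_vector_mult_scaleR)
  then obtain P :: "real^'n^'n" where P: "transpose P = P" "\<And>x. A *v (P *v x) = 0"
    "\<And>x. A *v x = 0 \<Longrightarrow> P *v x = x"
    by (rule orthogonal_projection_matrix_exists) simp
  have AP: "A ** P = 0"
    using P(2) by (simp add: matrix_eq flip: matrix_vector_mul_assoc)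
  have "P ** A = transpose (A ** P)"
    by (simp add: matrix_transpose_mul sym P(1))
  then have PA: "P ** A = 0"
    by (simp add: AP transpose_def zero_vec_def)
  have PP: "P ** P = P"
    using P(2,3) by (simp add: matrix_eq flip: matrix_vector_mul_assoc)
  have "x = 0" if "(A + P) *v x = 0" for x
  proof -
    \<comment> \<open>Applying \<open>P\<close> removes the \<open>A\<close> part, so a kernel
      vector of \<open>A + P\<close> satisfies P x = 0, then A x = 0, and finally x = P x =
      0.\<close>
    have "P *v ((A + P) *v x) = P *v x"
      by (simp add: matrix_vector_mul_assoc matrix_add_ldistrib PA PP)
    then have "P *v x = 0"
      using that by simp
    moreover from this have "A *v x = 0"
      using that by (simp add: matrix_vector_mult_add_rdistrib)
    ultimately show ?thesis
      using P(3) by simp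
  qed
  then obtain N where N: "N ** (A + P) = mat 1"
    using matrix_left_invertible_ker[of "A + P"] by blast
  then have N': "(A + P) ** N = mat 1"
    by (simp add: matrix_left_right_inverse)
  have NP: "N ** P = P"
  proof -
    have "N ** ((A + P) ** P) = P"
      by (simp add: matrix_mul_assoc N)
    then show ?thesis
      by (simp add: matrix_add_rdistrib AP PP)
  qed
  have PN: "P ** N = P"
  proof -
    have "(P ** (A + P)) ** N = P"
      by (simp add: N' flip: matrix_mul_assoc)
    then show ?thesis
      by (simp add: matrix_add_ldistrib PA PP)
  qed
  \<comment> \<open>Both products with \<open>N - P\<close> equal the symmetric projection
    \<open>mat 1 - P\<close>, which reduces the Penrose conditions to identities in
    \<open>P\<close>, \<open>A\<close> and \<open>N\<close>.\<close>
  have AX: "A ** (N - P) = mat 1 - P"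
    using N' by (simp add: matrix_diff_ldistrib matrix_add_rdistrib AP PN eq_diff_eq)
  have XA: "(N - P) ** A = mat 1 - P"
    using N by (simp add: matrix_diff_rdistrib matrix_add_ldistrib PA NP eq_diff_eq)
  have "transpose (mat 1 - P) = mat 1 - P"
    using P(1) by (simp add: transpose_def mat_def vec_eq_iff)
  then have "is_pseudoinverse A (N - P)"
    unfolding is_pseudoinverse_def AX XA
    by (simp add: matrix_diff_rdistrib matrix_diff_ldistrib PA PN PP)
  then show ?thesis ..
qed

lemma is_pseudoinverse_pseudoinverse:
  fixes A :: "real^'n^'n"
  assumes "transpose A = A"
  shows "is_pseudoinverse A (pseudoinverse A)"
  unfolding pseudoinverse_def
  using pseudoinverse_exists[OF assms] is_pseudoinverse_unique by (metis theI)

text \<open>The residual \<open>k\<close> lies in the kernel of \<open>A\<close>, because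
  transposing A X A = A gives A (A X) = A. The kernel is orthogonal to \<open>b\<close> by
  hypothesis and to the range of \<open>A\<close> by symmetry, so \<open>k\<close> is orthogonal to
  itself.\<close>

lemma pseudoinverse_solves:
  fixes A :: "real^'n^'n"
  assumes sym: "transpose A = A" and orth: "\<And>x. A *v x = 0 \<Longrightarrow> b \<bullet> x = 0"
  shows "A *v (pseudoinverse A *v b) = b"
proof -
  define X where "X = pseudoinverse A"
  have X: "A ** X ** A = A" "transpose (A ** X) = A ** X"
    using is_pseudoinverse_pseudoinverse[OF sym] by (auto simp: X_def is_pseudoinverse_def)
  define k where "k = b - A *v (X *v b)"
  have "A ** (A ** X) = transpose (A ** X ** A)"
    by (metis X(2) matrix_transpose_mul sym)
  then have "A ** (A ** X) = A"
    by (simp add: X(1) sym)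
  then have "A *v k = 0"
    by (simp add: k_def matrix_vector_mult_diff_distrib matrix_vector_mul_assoc)
  then have "b \<bullet> k = 0" "(A *v (X *v b)) \<bullet> k = 0"
    using orth symmetric_matrix_dot_commute[OF sym, of "X *v b" k] by simp_all
  then have "k \<bullet> k = 0"
    by (simp add: k_def inner_diff_left)
  then show ?thesis
    by (simp add: k_def X_def)
qed

lemma pseudoinverse_form_ge:
  fixes A :: "real^'n^'n"
  assumes sym: "transpose A = A" and psd: "\<And>x. x \<bullet> (A *v x) \<ge> 0"
    and orth: "\<And>x. A *v x = 0 \<Longrightarrow> b \<bullet> x = 0"
  shows "b \<bullet> (pseudoinverse A *v b) \<ge> 2 * (b \<bullet> x) - x \<bullet> (A *v x)"
proof -
  define z where "z = pseudoinverse A *v b"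
  have Az: "A *v z = b"
    unfolding z_def using sym orth by (rule pseudoinverse_solves)
  have "0 \<le> (z - x) \<bullet> (A *v (z - x))"
    by (rule psd)
  also have "\<dots> = b \<bullet> z - 2 * (b \<bullet> x) + x \<bullet> (A *v x)"
    using symmetric_matrix_dot_commute[OF sym, of z x]
    by (simp add: matrix_vector_mult_diff_distrib inner_diff_left inner_diff_right Az
        inner_commute)
  finally show ?thesis
    by (simp add: z_def)
qed

section \<open>The Laplacian and its quadratic form\<close>

lemma transpose_laplacian:
  assumes "simple_graph E"
  shows "transpose (laplacian E) = laplacian E"
  using assms
  by (auto simp: simple_graph_def transpose_def laplacian_def degree_matrix_def
      adjacency_matrix_def vec_eq_iff dest: sympD)

lemma laplacian_mult_nth:
  "(laplacian E *v x) $ i = (\<Sum>j\<in>UNIV. if E i j then x $ i - x $ j else 0)"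
proof -
  have "(laplacian E *v x) $ i =
      real (vertex_degree E i) * x $ i - (\<Sum>j\<in>UNIV. if E i j then x $ j else 0)"
    by (simp add: laplacian_def matrix_vector_mult_def degree_matrix_def adjacency_matrix_def
        left_diff_distrib sum_subtractf if_distrib[of "\<lambda>t. t * _"] cong: if_cong)
  also have "real (vertex_degree E i) * x $ i = (\<Sum>j\<in>UNIV. if E i j then x $ i else 0)"
    by (simp add: vertex_degree_def flip: sum.inter_filter)
  finally show ?thesis
    by (simp add: if_distrib flip: sum_subtractf cong: if_cong)
qed

text \<open>The factor 2 arises because the double sum meets each edge in both orientations; adding
  \<open>f i j\<close> and \<open>f j i\<close> completes the square.\<close>

lemma laplacian_form:
  assumes "simple_graph E"
  shows "2 * (x \<bullet> (laplacian E *v x)) =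
    (\<Sum>i\<in>UNIV. \<Sum>j\<in>UNIV. if E i j then (x $ i - x $ j)\<^sup>2 else 0)"
proof -
  define f where "f i j = (if E i j then x $ i * (x $ i - x $ j) else 0)" for i j
  have E: "E i j = E j i" for i j
    using assms by (auto simp: simple_graph_def dest: sympD)
  have form: "x \<bullet> (laplacian E *v x) = (\<Sum>i\<in>UNIV. \<Sum>j\<in>UNIV. f i j)"
    by (simp add: inner_vec_def laplacian_mult_nth f_def sum_distrib_left if_distrib cong: if_cong)
  have "2 * (x \<bullet> (laplacian E *v x)) =
      (\<Sum>i\<in>UNIV. \<Sum>j\<in>UNIV. f i j) + (\<Sum>i\<in>UNIV. \<Sum>j\<in>UNIV. f j i)"
    using sum.swap[of f UNIV UNIV] by (simp add: form)
  also have "\<dots> = (\<Sum>i\<in>UNIV. \<Sum>j\<in>UNIV. f i j + f j i)"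
    by (simp add: sum.distrib)
  also have "\<dots> = (\<Sum>i\<in>UNIV. \<Sum>j\<in>UNIV. if E i j then (x $ i - x $ j)\<^sup>2 else 0)"
    by (intro sum.cong refl) (auto simp: f_def E power2_eq_square algebra_simps)
  finally show ?thesis .
qed

lemma laplacian_form_nonneg:
  assumes "simple_graph E"
  shows "x \<bullet> (laplacian E *v x) \<ge> 0"
proof -
  have "0 \<le> 2 * (x \<bullet> (laplacian E *v x))"
    unfolding laplacian_form[OF assms] by (intro sum_nonneg) simp
  then show ?thesis
    by simp
qed

text \<open>A kernel vector has zero energy, so every squared difference along an edge vanishes.
  This is what makes the signed indicator of an edge orthogonal to the kernel.\<close>

lemma laplacian_kernel_adjacent:
  assumes "simple_graph E" "laplacian E *v x = 0" "E u v"
  shows "x $ u = x $ v"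
proof -
  have "(\<Sum>i\<in>UNIV. \<Sum>j\<in>UNIV. if E i j then (x $ i - x $ j)\<^sup>2 else 0) = 0"
    using laplacian_form[OF assms(1), of x] assms(2) by simp
  then have "(\<Sum>j\<in>UNIV. if E u j then (x $ u - x $ j)\<^sup>2 else 0) = 0"
    by (subst (asm) sum_nonneg_eq_0_iff) (auto intro: sum_nonneg)
  then have "(if E u v then (x $ u - x $ v)\<^sup>2 else 0) = 0"
    by (subst (asm) sum_nonneg_eq_0_iff) auto
  then show ?thesis
    using assms(3) by simp
qed

text \<open>Only the 2 by 2 block of the Laplacian at \<open>u\<close> and \<open>v\<close>
  contributes: the degrees on the diagonal and -1 off it.\<close>

lemma laplacian_form_edge_potential:
  fixes E :: "'v::finite \<Rightarrow> 'v \<Rightarrow> bool" and a c :: real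
  assumes "simple_graph E" "E u v"
  defines "x \<equiv> a *\<^sub>R axis u 1 + c *\<^sub>R axis v 1 :: real^'v"
  shows "x \<bullet> (laplacian E *v x) =
    a\<^sup>2 * real (vertex_degree E u) - 2 * a * c + c\<^sup>2 * real (vertex_degree E v)"
proof -
  have "E v u" "\<not> E u u" "\<not> E v v" "u \<noteq> v"
    using assms(1,2) by (auto simp: simple_graph_def dest: sympD irreflpD)
  then show ?thesis
    using assms(2)
    by (simp add: x_def inner_axis' matrix_vector_mul_component inner_axis laplacian_def
        degree_matrix_def adjacency_matrix_def power2_eq_square algebra_simps)
qed

section \<open>Lower bounds for the resistance of an edge\<close>

lemma effective_resistance_edge_ge:
  fixes E :: "'v::finite \<Rightarrow> 'v \<Rightarrow> bool" and a c :: real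
  assumes "simple_graph E" "E u v"
  shows "effective_resistance E u v \<ge>
    2 * (a - c) - (a\<^sup>2 * real (vertex_degree E u) - 2 * a * c + c\<^sup>2 * real (vertex_degree E v))"
proof -
  define b :: "real^'v" where "b = axis u 1 - axis v 1"
  define x :: "real^'v" where "x = a *\<^sub>R axis u 1 + c *\<^sub>R axis v 1"
  have "u \<noteq> v"
    using assms by (auto simp: simple_graph_def dest: irreflpD)
  then have "b \<bullet> x = a - c"
    by (simp add: b_def x_def inner_diff_left inner_axis') (simp add: axis_def)
  moreover have "b \<bullet> y = 0" if "laplacian E *v y = 0" for y
    using laplacian_kernel_adjacent[OF assms(1) that assms(2)]
    by (simp add: b_def inner_diff_left inner_axis')
  ultimately show ?thesis
    using pseudoinverse_form_ge[OF transpose_laplacian[OF assms(1)]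
        laplacian_form_nonneg[OF assms(1)], of b x]
      laplacian_form_edge_potential[OF assms, of a c]
    by (simp add: effective_resistance_def b_def x_def)
qed

theorem theorem3p9:
  fixes E :: "'v::finite \<Rightarrow> 'v \<Rightarrow> bool" and u v :: 'v
  assumes "simple_graph E"
    and "E u v"
    and "vertex_degree E u \<ge> 2 \<or> vertex_degree E v \<ge> 2"
  shows "effective_resistance E u v \<ge>
    max ((real (vertex_degree E v) + real (vertex_degree E u) - 2) /
           (real (vertex_degree E u) * real (vertex_degree E v) - 1))
        (4 / (real (vertex_degree E u) + real (vertex_degree E v) + 2))"
proof -
  \<comment> \<open>\<open>p\<close> and \<open>q\<close> count the neighbours of each endpoint
    other than the opposite one. In these terms the first bound is (p + q) / (p + q + p q) and the
    second is 4 / (p + q + 4).\<close>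
  define p where "p = real (vertex_degree E u) - 1"
  define q where "q = real (vertex_degree E v) - 1"
  have "E v u"
    using assms(1,2) by (auto simp: simple_graph_def dest: sympD)
  then have "vertex_degree E u \<ge> 1" "vertex_degree E v \<ge> 1"
    using assms(2) by (auto simp: vertex_degree_def Suc_le_eq card_gt_0_iff)
  then have nonneg: "p \<ge> 0" "q \<ge> 0"
    by (auto simp: p_def q_def)
  \<comment> \<open>The degree hypothesis excludes p = q = 0, where the denominator of the first
    bound would vanish.\<close>
  have pos: "p + q > 0"
    using nonneg assms(3) by (auto simp: p_def q_def)
  have ge: "effective_resistance E u v \<ge>
      2 * (a - c) - (a\<^sup>2 * (p + 1) - 2 * a * c + c\<^sup>2 * (q + 1))" for a c
    using effective_resistance_edge_ge[OF assms(1,2), of a c] by (simp add: p_def q_def)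
  define D where "D = p + q + p * q"
  have "D > 0"
    using pos nonneg by (simp add: D_def add_pos_nonneg)
  \<comment> \<open>The stationarity equations a (p + 1) - c = 1 and a - c (q + 1) = 1 have the
    solution a = q / D, c = - p / D.\<close>
  have "2 * (q / D - - p / D) - ((q / D)\<^sup>2 * (p + 1) - 2 * (q / D) * (- p / D)
      + (- p / D)\<^sup>2 * (q + 1)) = 2 * (p + q) / D - (p + q) * D / D\<^sup>2"
    by (simp add: D_def field_simps power2_eq_square add_divide_distrib diff_divide_distrib)
  also have "\<dots> = (p + q) / D"
    using \<open>D > 0\<close> by (simp add: field_simps power2_eq_square)
  finally have 1: "effective_resistance E u v \<ge> (p + q) / D"
    using ge[of "q / D" "- p / D"] by simp
  define S where "S = p + q + 4"
  have "S > 0"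
    using pos by (simp add: S_def)
  \<comment> \<open>For c = - a the lower bound becomes 4 a - S a^2, which is largest at a = 2 /
    S.\<close>
  have "2 * (2 / S - - 2 / S) - ((2 / S)\<^sup>2 * (p + 1) - 2 * (2 / S) * (- 2 / S)
      + (- 2 / S)\<^sup>2 * (q + 1)) = 8 / S - 4 * S / S\<^sup>2"
    by (simp add: S_def field_simps power2_eq_square add_divide_distrib diff_divide_distrib)
  also have "\<dots> = 4 / S"
    using \<open>S > 0\<close> by (simp add: field_simps power2_eq_square)
  finally have 2: "effective_resistance E u v \<ge> 4 / S"
    using ge[of "2 / S" "- 2 / S"] by simp
  show ?thesis
    using 1 2 by (simp add: p_def q_def D_def S_def algebra_simps)
qed

end
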